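(* Let $(V,U,\Lambda)$ be an efficient market equilibrium, and let $\gamma(k),\mu(k)$ ($k=0,\dots,N-1$) and $\underline{\nu}_i,\overline{\nu}_i$ ($i=1,\dots,n$) be corresponding Lagrange multipliers (as defined in the context). If $(\mathcal T,\mathcal F,\mathcal S,\mathcal E)$ is a simultaneously feasible collection of transmission and storage rights, then their corresponding rent satisfies $$\Phi(\mathcal T,\mathcal F)+\Sigma(\mathcal S,\mathcal E)\ \le\ \mathrm{MS}.$$ Moreover, this inequality is tight, in the sense that there exists a simultaneously feasible collection of rights $(\mathcal T,\mathcal F,\mathcal S,\mathcal E)$ with associated rent $\Phi(\mathcal T,\mathcal F)+\Sigma(\mathcal S,\mathcal E)=\mathrm{MS}$.
   Context: **Notation.** $\circ$ is the entrywise (Hadamard) product, $\mathbf 1$ the all-ones vector; vector inequalities are entrywise. **Network.** A connected graph with $n$ nodes and $m$ edges (transmission lines). $H\in\mathbb R^{2m\times n}$ is the shift-factor matrix of the DC power flow model: it maps a vector $x$ of nodal power injections with $\mathbf 1^\top x=0$ to the vector $Hx$ of power flows along the $2m$ directed transmission links (each line counted once in each direction). It satisfies $\operatorname{rank}(H)=n-1$, and $\mathbf 1^\top$ is linearly independent from the rows of $H$. $c\in\mathbb R^{2m}_+$ is the vector of line capacities. For $d\in\mathbb R^{2m}$ put $$\mathcal P(d)=\{x\in\mathbb R^n : Hx\le d,\ \mathbf 1^\top x=0\}.$$ **Costs.** There are $N$ time periods $k=0,\dots,N-1$. $C(v,k)=\sum_{i=1}^n C_i(v_i,k)$ for $v\in\mathbb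 R^n$, where each $C_i(\cdot,k):\mathbb R\to\mathbb R$ is increasing, convex and differentiable, with $C_i(0,k)=0$, $C_i(x,k)>0$ for $x>0$ and $C_i(x,k)<0$ for $x<0$. **Storage.** Node $i$ has storage capacity $b_i\ge 0$; $\mathbf b_i=(b_i,\dots,b_i)^\top\in\mathbb R^N$. $L\in\mathbb R^{N\times N}$ is lower triangular with $L_{k\ell}=-1$ for $k\ge\ell$ and $0$ otherwise. For $d\in\mathbb R^N$ put $$\mathcal U(d)=\{u\in\mathbb R^N : 0\le Lu\le d\}.$$ **Economic dispatch.** Write $V=[v(0),\dots,v(N-1)]$, $U=[u(0),\dots,u(N-1)]\in\mathbb R^{n\times N}$; $u_i=(u_i(0),\dots,u_i(N-1))^\top$ is the $i$-th row of $U$ as a column vector (the same row/column convention is used for other arrays). The pair $(V,U)$ is a feasible dispatch if $$v(k)+u(k)\in\mathcal P(c)\ (k=0,\dots,N-1),\qquad u_i\in\mathcal U(\mathbf b_i)\ (i=1,\dots,n),$$ and is an economic dispatch if it minimizes $\sum_{k=0}^{N-1}C(v(k),k)$ over all feasible dispatches. **Equilibrium.** Let $\Lambda=[\lambda(0),\dots,\lambda(N-1)]\in\mathbb R^{n\times N}$ (nodal prices), with $\lambda_i=(\lambda_i(0),\dots,\lambda_i(N-1))^\top$. $(V,U,\Lambda)$ is a market equilibrium if $(V,U)$ is a feasible dispatch and $\nabla C(v(k),k)=\lambda(k)$ for all $k$ (gradient in the first argument). It is an efficient market equilibrium if, in addition, $(V,U)$ is an economic dispatch. **Lagrange multipliers.**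 Corresponding Lagrange multipliers are $\gamma(k)\in\mathbb R$, $\mu(k)\in\mathbb R^{2m}_+$, $\underline\nu_i,\overline\nu_i\in\mathbb R^N_+$ satisfying, for all $k$ and $i$, $$\lambda(k)=\gamma(k)\mathbf 1-H^\top\mu(k),\quad L^\top(\overline\nu_i-\underline\nu_i)=\lambda_i,\quad \mu(k)\circ\bigl(H(v(k)+u(k))-c\bigr)=0,$$ $$\underline\nu_i\circ Lu_i=0,\quad \overline\nu_i\circ(\mathbf b_i-Lu_i)=0.$$ For $\ell=1,\dots,2m$ write $\mu_\ell=(\mu_\ell(0),\dots,\mu_\ell(N-1))^\top$. **Merchandising surplus.** $\mathrm{MS}=-\sum_{k=0}^{N-1}\sum_{i=1}^n\lambda_i(k)v_i(k)$. **Rights.** A collection of transmission and storage rights consists of: $\mathcal T=\{t_{ij}\in\mathbb R^N_+: i,j=1,\dots,n\}$ (point-to-point financial transmission rights, FTRs), $\mathcal F=\{f_\ell\in\mathbb R^N_+:\ell=1,\dots,2m\}$ (flowgate rights), $\mathcal S=\{s_i\in\mathbb R^N: i=1,\dots,n\}$ (financial storage rights), $\mathcal E=\{e_i\in\mathbb R^N_+: i=1,\dots,n\}$ (energy capacity rights). Their rents are $$\Phi(\mathcal T,\mathcal F)=\sum_{i,j=1}^n(\lambda_j-\lambda_i)^\top t_{ij}+\sum_{\ell=1}^{2m}\mu_\ell^\top f_\ell,\qquad \Sigma(\mathcal S,\mathcal E)=\sum_{i=1}^n\bigl(\lambda_i^\top s_i+\overline\nu_i^\top e_i\bigr).$$ For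 each $k$, $t(k)\in\mathbb R^n$ is the net injection vector $t_i(k)=\sum_{j=1}^n(t_{ij}(k)-t_{ji}(k))$, $f(k)\in\mathbb R^{2m}$ has entries $f_\ell(k)$, and $s(k)\in\mathbb R^n$ has entries $s_i(k)$. **Simultaneous feasibility.** $(\mathcal T,\mathcal F,\mathcal S,\mathcal E)$ is simultaneously feasible if there exists $Q=[q(0),\dots,q(N-1)]\in\mathbb R^{n\times N}$, with $i$-th row $q_i$, such that $$t(k)-s(k)+q(k)\in\mathcal P(c-f(k))\ (k=0,\dots,N-1),\qquad q_i\in\mathcal U(\mathbf b_i-e_i)\ (i=1,\dots,n).$$ *)

theory Defs
  imports "HOL-Analysis.Analysis"
begin

text \<open>
  Nodes are the elements of a finite type \<open>'n\<close>, lines those of a finite type \<open>'m\<close>, and time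
  periods those of a finite linear order \<open>'t\<close>.  Each line \<open>e\<close> joins the nodes \<open>src e\<close> and \<open>tgt e\<close>
  and gives the two directed links \<open>(e, True)\<close> (from \<open>src e\<close> to \<open>tgt e\<close>) and \<open>(e, False)\<close> (the
  reverse one), so that \<open>'m \<times> bool\<close> indexes the directed links.  Parallel lines are allowed; so
  are loops, which carry no flow and make the one-node network representable.

  An array \<open>X = [x(0), ..., x(N-1)]\<close> is a matrix of type \<open>real^'t^'n\<close>, i.e. \<open>('n, 't) array\<close>: \<open>x(k)\<close> is
  \<open>column k X\<close> and \<open>x\<^sub>i\<close> is \<open>row i X\<close>.  On vectors the library's \<open>*\<close>, \<open>1\<close> and \<open>\<le>\<close> are the Hadamard
  product, the all-ones vector and the entrywise order.
\<close>

type_synonym ('r, 't) array = "((real, 't) vec, 'r) vec"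


section \<open>Network\<close>

definition connected_graph :: "('m::finite \<Rightarrow> 'n::finite) \<Rightarrow> ('m \<Rightarrow> 'n) \<Rightarrow> bool" where
  "connected_graph src tgt \<longleftrightarrow>
     (\<forall>i j. (i, j) \<in> ((\<Union>e. {(src e, tgt e), (tgt e, src e)})\<^sup>*))"

fun link_from :: "('m \<Rightarrow> 'n) \<Rightarrow> ('m \<Rightarrow> 'n) \<Rightarrow> 'm \<times> bool \<Rightarrow> 'n" where
  "link_from src tgt (e, fwd) = (if fwd then src e else tgt e)"

fun link_to :: "('m \<Rightarrow> 'n) \<Rightarrow> ('m \<Rightarrow> 'n) \<Rightarrow> 'm \<times> bool \<Rightarrow> 'n" where
  "link_to src tgt (e, fwd) = (if fwd then tgt e else src e)"

text \<open>
  DC power flow: with line susceptances \<open>\<beta>\<close> and voltage angles \<open>\<theta>\<close>, the flow on a link from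
  \<open>i\<close> to \<open>j\<close> over line \<open>e\<close> is \<open>\<beta> e * (\<theta>$i - \<theta>$j)\<close>, and the net injection at a node is the total
  flow on the links leaving it (each line is incident to a node through one outgoing link, on which
  an incoming flow counts negatively).
\<close>

definition dc_flow ::
  "('m::finite \<Rightarrow> 'n::finite) \<Rightarrow> ('m \<Rightarrow> 'n) \<Rightarrow> ('m \<Rightarrow> real) \<Rightarrow> real^'n \<Rightarrow> real^('m \<times> bool)" where
  "dc_flow src tgt \<beta> \<theta> =
     (\<chi> l. \<beta> (fst l) * (\<theta> $ link_from src tgt l - \<theta> $ link_to src tgt l))"

definition dc_injection ::
  "('m::finite \<Rightarrow> 'n::finite) \<Rightarrow> ('m \<Rightarrow> 'n) \<Rightarrow> ('m \<Rightarrow> real) \<Rightarrow> real^'n \<Rightarrow> real^'n" where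
  "dc_injection src tgt \<beta> \<theta> =
     (\<chi> i. \<Sum>l | link_from src tgt l = i. dc_flow src tgt \<beta> \<theta> $ l)"

text \<open>
  The flow condition determines \<open>H\<close> only up to adding multiples of \<open>1\<close> to its rows; the
  last two conditions constrain that choice.
\<close>

definition shift_factor_matrix ::
  "('m::finite \<Rightarrow> 'n::finite) \<Rightarrow> ('m \<Rightarrow> 'n) \<Rightarrow> ('m \<Rightarrow> real) \<Rightarrow> real^'n^('m \<times> bool) \<Rightarrow> bool" where
  "shift_factor_matrix src tgt \<beta> H \<longleftrightarrow>
     (\<forall>x. 1 \<bullet> x = 0 \<longrightarrow> (\<exists>\<theta>. dc_injection src tgt \<beta> \<theta> = x \<and> H *v x = dc_flow src tgt \<beta> \<theta>)) \<and>
     rank H = CARD('n) - 1 \<and>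
     1 \<notin> span (rows H)"

definition power_network ::
  "('m::finite \<Rightarrow> 'n::finite) \<Rightarrow> ('m \<Rightarrow> 'n) \<Rightarrow> ('m \<Rightarrow> real) \<Rightarrow> real^'n^('m \<times> bool)
     \<Rightarrow> real^('m \<times> bool) \<Rightarrow> bool" where
  "power_network src tgt \<beta> H c \<longleftrightarrow>
     connected_graph src tgt \<and> (\<forall>e. 0 < \<beta> e) \<and> shift_factor_matrix src tgt \<beta> H \<and> 0 \<le> c"

definition injection_polytope :: "real^'n^'l \<Rightarrow> real^'l \<Rightarrow> (real^'n) set" where
  "injection_polytope H d = {x. H *v x \<le> d \<and> 1 \<bullet> x = 0}"


section \<open>Costs and storage\<close>

definition cost_functions :: "('n \<Rightarrow> 't \<Rightarrow> real \<Rightarrow> real) \<Rightarrow> bool" where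
  "cost_functions C \<longleftrightarrow>
     (\<forall>i k. mono (C i k) \<and> convex_on UNIV (C i k) \<and> (\<forall>x. C i k differentiable (at x)) \<and>
        C i k 0 = 0 \<and> (\<forall>x>0. C i k x > 0) \<and> (\<forall>x<0. C i k x < 0))"

definition total_cost :: "('n::finite \<Rightarrow> 't \<Rightarrow> real \<Rightarrow> real) \<Rightarrow> 't \<Rightarrow> real^'n \<Rightarrow> real" where
  "total_cost C k v = (\<Sum>i\<in>UNIV. C i k (v $ i))"

definition storage_matrix :: "real^('t::{finite,linorder})^('t::{finite,linorder})" where
  "storage_matrix = (\<chi> k l. if l \<le> k then -1 else 0)"

definition storage_polytope :: "real^('t::{finite,linorder}) \<Rightarrow> (real^('t::{finite,linorder})) set" where
  "storage_polytope d = {u. 0 \<le> storage_matrix *v u \<and> storage_matrix *v u \<le> d}"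


section \<open>Economic dispatch and market equilibrium\<close>

definition feasible_dispatch ::
  "real^'n^'l \<Rightarrow> real^'l \<Rightarrow> real^'n \<Rightarrow> ('n, 't::{finite,linorder}) array \<Rightarrow> ('n, 't) array \<Rightarrow> bool" where
  "feasible_dispatch H c b V U \<longleftrightarrow>
     (\<forall>k. column k V + column k U \<in> injection_polytope H c) \<and>
     (\<forall>i. row i U \<in> storage_polytope (vec (b $ i)))"

definition economic_dispatch ::
  "real^'n^'l \<Rightarrow> real^'l \<Rightarrow> real^'n \<Rightarrow> ('n \<Rightarrow> 't \<Rightarrow> real \<Rightarrow> real)
     \<Rightarrow> ('n, 't::{finite,linorder}) array \<Rightarrow> ('n, 't) array \<Rightarrow> bool" where
  "economic_dispatch H c b C V U \<longleftrightarrow>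
     feasible_dispatch H c b V U \<and>
     (\<forall>V' U'. feasible_dispatch H c b V' U' \<longrightarrow>
        (\<Sum>k\<in>UNIV. total_cost C k (column k V)) \<le> (\<Sum>k\<in>UNIV. total_cost C k (column k V')))"

definition market_equilibrium ::
  "real^'n^'l \<Rightarrow> real^'l \<Rightarrow> real^'n \<Rightarrow> ('n \<Rightarrow> 't \<Rightarrow> real \<Rightarrow> real)
     \<Rightarrow> ('n, 't::{finite,linorder}) array \<Rightarrow> ('n, 't) array \<Rightarrow> ('n, 't) array \<Rightarrow> bool" where
  "market_equilibrium H c b C V U \<Lambda> \<longleftrightarrow>
     feasible_dispatch H c b V U \<and>
     (\<forall>k. GDERIV (total_cost C k) (column k V) :> column k \<Lambda>)"

definition efficient_market_equilibrium ::
  "real^'n^'l \<Rightarrow> real^'l \<Rightarrow> real^'n \<Rightarrow> ('n \<Rightarrow> 't \<Rightarrow> real \<Rightarrow> real)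
     \<Rightarrow> ('n, 't::{finite,linorder}) array \<Rightarrow> ('n, 't) array \<Rightarrow> ('n, 't) array \<Rightarrow> bool" where
  "efficient_market_equilibrium H c b C V U \<Lambda> \<longleftrightarrow>
     market_equilibrium H c b C V U \<Lambda> \<and> economic_dispatch H c b C V U"

text \<open>\<open>\<nu>l\<close> and \<open>\<nu>u\<close> are the multipliers of the lower and upper storage bounds.\<close>

definition lagrange_multipliers ::
  "real^'n^'l \<Rightarrow> real^'l \<Rightarrow> real^'n \<Rightarrow> ('n, 't::{finite,linorder}) array \<Rightarrow> ('n, 't) array \<Rightarrow> ('n, 't) array
     \<Rightarrow> (real, 't) vec \<Rightarrow> ('l, 't) array \<Rightarrow> ('n, 't) array \<Rightarrow> ('n, 't) array \<Rightarrow> bool" where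
  "lagrange_multipliers H c b V U \<Lambda> \<gamma> \<mu> \<nu>l \<nu>u \<longleftrightarrow>
     (\<forall>k. 0 \<le> column k \<mu> \<and>
        column k \<Lambda> = (\<gamma> $ k) *\<^sub>R 1 - transpose H *v column k \<mu> \<and>
        column k \<mu> * (H *v (column k V + column k U) - c) = 0) \<and>
     (\<forall>i. 0 \<le> row i \<nu>l \<and> 0 \<le> row i \<nu>u \<and>
        transpose storage_matrix *v (row i \<nu>u - row i \<nu>l) = row i \<Lambda> \<and>
        row i \<nu>l * (storage_matrix *v row i U) = 0 \<and>
        row i \<nu>u * (vec (b $ i) - storage_matrix *v row i U) = 0)"

definition merchandising_surplus :: "real^'t::finite^'n \<Rightarrow> real^'t^'n \<Rightarrow> real" where
  "merchandising_surplus \<Lambda> V = - (\<Sum>k\<in>UNIV. \<Sum>i\<in>UNIV. \<Lambda> $ i $ k * V $ i $ k)"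


section \<open>Transmission and storage rights\<close>

record ('n, 'l, 't) rights =
  ftr :: "'n \<Rightarrow> 'n \<Rightarrow> real^'t"
  flowgate :: "real^'t^'l"
  storage_right :: "real^'t^'n"
  energy_right :: "real^'t^'n"

definition valid_rights :: "('n::finite, 'l::finite, 't::finite) rights \<Rightarrow> bool" where
  "valid_rights R \<longleftrightarrow>
     (\<forall>i j. 0 \<le> ftr R i j) \<and> (\<forall>l. 0 \<le> row l (flowgate R)) \<and> (\<forall>i. 0 \<le> row i (energy_right R))"

definition net_injection :: "('n::finite, 'l::finite, 't::finite) rights \<Rightarrow> 't \<Rightarrow> real^'n" where
  "net_injection R k = (\<chi> i. \<Sum>j\<in>UNIV. ftr R i j $ k - ftr R j i $ k)"

definition transmission_rent ::
  "real^'t^'n \<Rightarrow> real^'t^'l \<Rightarrow> ('n::finite, 'l::finite, 't::finite) rights \<Rightarrow> real" where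
  "transmission_rent \<Lambda> \<mu> R =
     (\<Sum>i\<in>UNIV. \<Sum>j\<in>UNIV. (row j \<Lambda> - row i \<Lambda>) \<bullet> ftr R i j) +
     (\<Sum>l\<in>UNIV. row l \<mu> \<bullet> row l (flowgate R))"

definition storage_rent ::
  "real^'t^'n \<Rightarrow> real^'t^'n \<Rightarrow> ('n::finite, 'l::finite, 't::finite) rights \<Rightarrow> real" where
  "storage_rent \<Lambda> \<nu>u R =
     (\<Sum>i\<in>UNIV. row i \<Lambda> \<bullet> row i (storage_right R) + row i \<nu>u \<bullet> row i (energy_right R))"

definition simultaneously_feasible ::
  "real^'n^'l \<Rightarrow> real^'l \<Rightarrow> real^'n \<Rightarrow> ('n::finite, 'l::finite, 't::{finite,linorder}) rights \<Rightarrow> bool"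
where
  "simultaneously_feasible H c b R \<longleftrightarrow>
     (\<exists>Q :: real^('t::{finite,linorder})^'n.
        (\<forall>k. net_injection R k - column k (storage_right R) + column k Q
               \<in> injection_polytope H (c - column k (flowgate R))) \<and>
        (\<forall>i. row i Q \<in> storage_polytope (vec (b $ i) - row i (energy_right R))))"

end

theory Submission
  imports Defs
begin

text \<open>
  Both sides of the inequality are compared with \<open>\<Sum>k. \<mu>(k) \<bullet> c + \<Sum>i. \<nu>u\<^sub>i \<bullet> vec b\<^sub>i\<close>, the congestion
  rent of the lines plus the scarcity rent of the storage capacities.

  The multipliers price the two polytopes.  Since \<open>\<lambda>(k)\<close> is \<open>- H\<^sup>T \<mu>(k)\<close> up to a multiple of the
  all-ones vector, a balanced injection \<open>x\<close> satisfies \<open>- \<lambda>(k) \<bullet> x = \<mu>(k) \<bullet> H x\<close>, which is at most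
  \<open>\<mu>(k) \<bullet> d\<close> on the injection polytope with capacities \<open>d\<close>
  (\<open>injection_value_le_congestion_rent\<close>).  Likewise \<open>\<lambda>\<^sub>i \<bullet> u = (\<nu>u\<^sub>i - \<nu>l\<^sub>i) \<bullet> L u\<close> is at most
  \<open>\<nu>u\<^sub>i \<bullet> d\<close> on the storage polytope with capacities \<open>d\<close> (\<open>storage_value_le_scarcity_rent\<close>).  By
  complementary slackness the dispatch attains both bounds, so that splitting \<open>V\<close> into
  \<open>(V + U) - U\<close> turns the merchandising surplus into the common value above
  (\<open>merchandising_surplus_eq_capacity_rent\<close>).

  For rights that are simultaneously feasible through \<open>Q\<close>, the injections \<open>t - s + q\<close> and the storage
  operation \<open>q\<close> are bounded by the capacities left over after the flowgate rights \<open>f\<close> and the energy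
  rights \<open>e\<close>.  The terms \<open>\<mu> \<bullet> f\<close> and \<open>\<nu>u \<bullet> e\<close> that these bounds lack are exactly the rents paid to
  \<open>f\<close> and \<open>e\<close>, and the value of \<open>q\<close> cancels.  The bound is attained because the storage rights
  \<open>s = - V\<close> alone, supported by \<open>Q = U\<close>, replicate the dispatch.
\<close>

section \<open>Inner products of arrays and vectors\<close>

lemma inner_eq_sum_rows:
  fixes A B :: "real^'t::finite^'n::finite"
  shows "A \<bullet> B = (\<Sum>i\<in>UNIV. row i A \<bullet> row i B)"
  by (simp add: inner_vec_def row_def)

lemma inner_eq_sum_columns:
  fixes A B :: "real^'t::finite^'n::finite"
  shows "A \<bullet> B = (\<Sum>k\<in>UNIV. column k A \<bullet> column k B)"
  unfolding inner_vec_def column_def by (simp, rule sum.swap)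

lemma inner_nonneg_mono:
  fixes a x y :: "real^'l::finite"
  assumes "0 \<le> a" "x \<le> y"
  shows "a \<bullet> x \<le> a \<bullet> y"
  using assms unfolding inner_vec_def
  by (auto simp: less_eq_vec_def intro!: sum_mono mult_left_mono)

lemma inner_eq_0_if_hadamard_eq_0:
  fixes a x :: "real^'l::finite"
  assumes "a * x = 0"
  shows "a \<bullet> x = 0"
  using assms unfolding inner_vec_def by (intro sum.neutral) (simp add: vec_eq_iff)


section \<open>Prices as values of capacity\<close>

text \<open>The energy component \<open>\<gamma>\<close> of the price drops out on balanced injections.\<close>

lemma injection_value_eq_flow_value:
  fixes H :: "real^'n::finite^'l::finite"
  assumes "p = g *\<^sub>R 1 - transpose H *v m" "1 \<bullet> x = 0"
  shows "- (p \<bullet> x) = m \<bullet> (H *v x)"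
  using assms by (simp add: inner_diff_left dot_lmul_matrix)

lemma injection_value_le_congestion_rent:
  fixes H :: "real^'n::finite^'l::finite"
  assumes "p = g *\<^sub>R 1 - transpose H *v m" "0 \<le> m" "x \<in> injection_polytope H d"
  shows "- (p \<bullet> x) \<le> m \<bullet> d"
  using assms injection_value_eq_flow_value[OF assms(1)] inner_nonneg_mono
  by (auto simp: injection_polytope_def)

lemma injection_value_eq_congestion_rent:
  fixes H :: "real^'n::finite^'l::finite"
  assumes "p = g *\<^sub>R 1 - transpose H *v m" "x \<in> injection_polytope H d"
    and "m * (H *v x - d) = 0"
  shows "- (p \<bullet> x) = m \<bullet> d"
  using assms(2) injection_value_eq_flow_value[OF assms(1)] inner_eq_0_if_hadamard_eq_0[OF assms(3)]
  by (simp add: injection_polytope_def inner_diff_right)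

lemma storage_value_eq:
  fixes u p :: "real^'t::{finite,linorder}"
  assumes "transpose storage_matrix *v (nu - nl) = p"
  shows "p \<bullet> u = nu \<bullet> (storage_matrix *v u) - nl \<bullet> (storage_matrix *v u)"
  by (simp add: assms[symmetric] dot_lmul_matrix inner_diff_left)

lemma storage_value_le_scarcity_rent:
  fixes u p :: "real^'t::{finite,linorder}"
  assumes "transpose storage_matrix *v (nu - nl) = p" "0 \<le> nl" "0 \<le> nu"
    and "u \<in> storage_polytope d"
  shows "p \<bullet> u \<le> nu \<bullet> d"
proof -
  have "nu \<bullet> (storage_matrix *v u) \<le> nu \<bullet> d"
    using assms by (auto simp: storage_polytope_def intro!: inner_nonneg_mono)
  moreover have "nl \<bullet> 0 \<le> nl \<bullet> (storage_matrix *v u)"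
    using assms by (intro inner_nonneg_mono) (auto simp: storage_polytope_def)
  ultimately show ?thesis by (simp add: storage_value_eq[OF assms(1)])
qed

lemma storage_value_eq_scarcity_rent:
  fixes u p :: "real^'t::{finite,linorder}"
  assumes "transpose storage_matrix *v (nu - nl) = p"
    and "nl * (storage_matrix *v u) = 0" "nu * (d - storage_matrix *v u) = 0"
  shows "p \<bullet> u = nu \<bullet> d"
  using inner_eq_0_if_hadamard_eq_0[OF assms(2)] inner_eq_0_if_hadamard_eq_0[OF assms(3)]
  by (simp add: storage_value_eq[OF assms(1)] inner_diff_right)


section \<open>Surplus and rents\<close>

lemma merchandising_surplus_eq_inner: "merchandising_surplus \<Lambda> V = - (\<Lambda> \<bullet> V)"
  unfolding merchandising_surplus_def inner_vec_def by (simp, rule sum.swap)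

lemma merchandising_surplus_eq_capacity_rent:
  fixes V U \<Lambda> \<nu>l \<nu>u :: "real^('t::{finite,linorder})^'n::finite" and \<mu> :: "real^('t::{finite,linorder})^'l::finite"
  assumes "feasible_dispatch H c b V U" "lagrange_multipliers H c b V U \<Lambda> \<gamma> \<mu> \<nu>l \<nu>u"
  shows "merchandising_surplus \<Lambda> V =
    (\<Sum>k\<in>UNIV. column k \<mu> \<bullet> c) + (\<Sum>i\<in>UNIV. row i \<nu>u \<bullet> vec (b $ i))"
proof -
  have "- (column k \<Lambda> \<bullet> (column k V + column k U)) = column k \<mu> \<bullet> c" for k
    using assms
    by (intro injection_value_eq_congestion_rent[where H = H and g = "\<gamma> $ k"])
      (auto simp: feasible_dispatch_def lagrange_multipliers_def)
  then have "(\<Sum>k\<in>UNIV. column k \<mu> \<bullet> c) =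
      (\<Sum>k\<in>UNIV. - (column k \<Lambda> \<bullet> (column k V + column k U)))"
    by simp
  also have "\<dots> = - (\<Lambda> \<bullet> V) - \<Lambda> \<bullet> U"
    by (simp add: inner_eq_sum_columns inner_add_right sum_negf sum.distrib sum_subtractf)
  finally have congestion: "(\<Sum>k\<in>UNIV. column k \<mu> \<bullet> c) = - (\<Lambda> \<bullet> V) - \<Lambda> \<bullet> U" .
  have "row i \<Lambda> \<bullet> row i U = row i \<nu>u \<bullet> vec (b $ i)" for i
    using assms(2)
    by (intro storage_value_eq_scarcity_rent[where nl = "row i \<nu>l"])
      (auto simp: lagrange_multipliers_def)
  then have "\<Lambda> \<bullet> U = (\<Sum>i\<in>UNIV. row i \<nu>u \<bullet> vec (b $ i))"
    by (simp add: inner_eq_sum_rows)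
  with congestion show ?thesis by (simp add: merchandising_surplus_eq_inner)
qed

text \<open>
  A point-to-point right pays what its transfer is worth: \<open>ftr R i j\<close> injected at \<open>i\<close> and withdrawn
  at \<open>j\<close>.  Adding up the transfers leaves only their net injection.
\<close>

lemma ftr_rent_eq_net_injection_value:
  fixes \<Lambda> :: "real^'t::finite^'n::finite" and R :: "('n, 'l::finite, 't) rights"
  shows "(\<Sum>i\<in>UNIV. \<Sum>j\<in>UNIV. (row j \<Lambda> - row i \<Lambda>) \<bullet> ftr R i j) =
    - (\<Sum>k\<in>UNIV. column k \<Lambda> \<bullet> net_injection R k)"
proof -
  have "(\<Sum>k\<in>UNIV. column k \<Lambda> \<bullet> net_injection R k) =
      (\<Sum>k\<in>UNIV. \<Sum>i\<in>UNIV. \<Sum>j\<in>UNIV. \<Lambda> $ i $ k * (ftr R i j $ k - ftr R j i $ k))"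
    by (simp add: inner_vec_def column_def net_injection_def sum_distrib_left)
  also have "\<dots> = (\<Sum>i\<in>UNIV. \<Sum>j\<in>UNIV. \<Sum>k\<in>UNIV. \<Lambda> $ i $ k * (ftr R i j $ k - ftr R j i $ k))"
    by (subst sum.swap, rule sum.cong[OF refl], rule sum.swap)
  also have "\<dots> = (\<Sum>i\<in>UNIV. \<Sum>j\<in>UNIV. row i \<Lambda> \<bullet> ftr R i j) - (\<Sum>i\<in>UNIV. \<Sum>j\<in>UNIV. row i \<Lambda> \<bullet> ftr R j i)"
    by (simp add: inner_vec_def row_def right_diff_distrib sum_subtractf)
  also have "(\<Sum>i\<in>UNIV. \<Sum>j\<in>UNIV. row i \<Lambda> \<bullet> ftr R j i) = (\<Sum>i\<in>UNIV. \<Sum>j\<in>UNIV. row j \<Lambda> \<bullet> ftr R i j)"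
    by (rule sum.swap)
  finally show ?thesis by (simp add: inner_diff_left sum_subtractf)
qed

lemma rent_eq:
  fixes \<Lambda> \<nu>u :: "real^'t::finite^'n::finite" and R :: "('n, 'l::finite, 't) rights"
  shows "transmission_rent \<Lambda> \<mu> R + storage_rent \<Lambda> \<nu>u R =
    - (\<Sum>k\<in>UNIV. column k \<Lambda> \<bullet> net_injection R k) + \<mu> \<bullet> flowgate R
    + \<Lambda> \<bullet> storage_right R + \<nu>u \<bullet> energy_right R"
  by (simp add: transmission_rent_def storage_rent_def ftr_rent_eq_net_injection_value
      inner_eq_sum_rows sum.distrib)

text \<open>
  Capacity sold as flowgate or energy rights is paid for at its multiplier, and the remaining
  capacity bounds the value of \<open>t - s + q\<close> and \<open>q\<close> at the same multipliers.  Together the full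
  capacities are priced once, and the witness \<open>q\<close>, which enters both bounds, drops out.
\<close>

lemma rent_le_capacity_rent:
  fixes V U \<Lambda> \<nu>l \<nu>u :: "real^('t::{finite,linorder})^'n::finite"
    and R :: "('n, 'l::finite, 't) rights"
  assumes "lagrange_multipliers H c b V U \<Lambda> \<gamma> \<mu> \<nu>l \<nu>u" "simultaneously_feasible H c b R"
  shows "transmission_rent \<Lambda> \<mu> R + storage_rent \<Lambda> \<nu>u R
    \<le> (\<Sum>k\<in>UNIV. column k \<mu> \<bullet> c) + (\<Sum>i\<in>UNIV. row i \<nu>u \<bullet> vec (b $ i))"
proof -
  let ?S = "storage_right R" and ?F = "flowgate R" and ?E = "energy_right R"
  obtain Q :: "real^('t::{finite,linorder})^'n" where
    Q_network: "\<And>k. net_injection R k - column k ?S + column k Q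
      \<in> injection_polytope H (c - column k ?F)" and
    Q_storage: "\<And>i. row i Q \<in> storage_polytope (vec (b $ i) - row i ?E)"
    using assms(2) unfolding simultaneously_feasible_def by blast
  have "- (column k \<Lambda> \<bullet> (net_injection R k - column k ?S + column k Q))
      \<le> column k \<mu> \<bullet> (c - column k ?F)" for k
    using assms(1) Q_network
    by (intro injection_value_le_congestion_rent[where H = H and g = "\<gamma> $ k"])
      (auto simp: lagrange_multipliers_def)
  then have "(\<Sum>k\<in>UNIV. - (column k \<Lambda> \<bullet> (net_injection R k - column k ?S + column k Q)))
      \<le> (\<Sum>k\<in>UNIV. column k \<mu> \<bullet> (c - column k ?F))"
    by (rule sum_mono)
  then have "- (\<Sum>k\<in>UNIV. column k \<Lambda> \<bullet> net_injection R k) + \<Lambda> \<bullet> ?S - \<Lambda> \<bullet> Q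
      \<le> (\<Sum>k\<in>UNIV. column k \<mu> \<bullet> c) - \<mu> \<bullet> ?F"
    by (simp add: inner_eq_sum_columns inner_add_right inner_diff_right sum_negf sum.distrib
        sum_subtractf)
  moreover have "row i \<Lambda> \<bullet> row i Q \<le> row i \<nu>u \<bullet> (vec (b $ i) - row i ?E)" for i
    using assms(1) Q_storage
    by (intro storage_value_le_scarcity_rent[where nl = "row i \<nu>l"])
      (auto simp: lagrange_multipliers_def)
  then have "(\<Sum>i\<in>UNIV. row i \<Lambda> \<bullet> row i Q)
      \<le> (\<Sum>i\<in>UNIV. row i \<nu>u \<bullet> (vec (b $ i) - row i ?E))"
    by (rule sum_mono)
  then have "\<Lambda> \<bullet> Q \<le> (\<Sum>i\<in>UNIV. row i \<nu>u \<bullet> vec (b $ i)) - \<nu>u \<bullet> ?E"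
    by (simp add: inner_eq_sum_rows inner_diff_right sum_subtractf)
  ultimately show ?thesis unfolding rent_eq by linarith
qed

text \<open>
  Holding \<open>- V\<close> as storage rights pays the surplus by definition, and supporting them with \<open>Q = U\<close>
  reproduces the injections \<open>V + U\<close> of the dispatch.
\<close>

lemma ex_rights_with_rent_eq_surplus:
  fixes V U \<Lambda> \<nu>u :: "real^('t::{finite,linorder})^'n::finite" and \<mu> :: "real^('t::{finite,linorder})^'l::finite"
  assumes "feasible_dispatch H c b V U"
  shows "\<exists>R :: ('n, 'l, 't) rights. valid_rights R \<and> simultaneously_feasible H c b R \<and>
    transmission_rent \<Lambda> \<mu> R + storage_rent \<Lambda> \<nu>u R = merchandising_surplus \<Lambda> V"
proof -
  define R :: "('n, 'l, 't) rights" where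
    "R = \<lparr>ftr = \<lambda>_ _. 0, flowgate = 0, storage_right = - V, energy_right = 0\<rparr>"
  have net: "net_injection R k = 0" for k
    by (simp add: R_def net_injection_def vec_eq_iff)
  have col: "column k (- V) = - column k V" "column k (0 :: real^('t::{finite,linorder})^'l) = 0"
    and row: "row i (0 :: real^('t::{finite,linorder})^'n) = 0" for k i
    by (simp_all add: column_def row_def vec_eq_iff)
  have "valid_rights R"
    by (simp add: R_def valid_rights_def row_def less_eq_vec_def)
  moreover have "simultaneously_feasible H c b R"
    unfolding simultaneously_feasible_def net
    using assms by (intro exI[of _ U]) (simp add: R_def feasible_dispatch_def col row)
  moreover have "transmission_rent \<Lambda> \<mu> R + storage_rent \<Lambda> \<nu>u R = merchandising_surplus \<Lambda> V"
    unfolding rent_eq net by (simp add: R_def merchandising_surplus_eq_inner)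
  ultimately show ?thesis by blast
qed


section \<open>Adequacy of rents\<close>

theorem theorem1:
  fixes src tgt :: "'m::finite \<Rightarrow> 'n::finite"
    and \<beta> :: "'m \<Rightarrow> real"
    and H :: "real^'n^('m \<times> bool)"
    and c :: "real^('m \<times> bool)"
    and b :: "real^'n"
    and C :: "'n \<Rightarrow> 't::{finite,linorder} \<Rightarrow> real \<Rightarrow> real"
    and V U \<Lambda> \<nu>l \<nu>u :: "real^('t::{finite,linorder})^'n"
    and \<gamma> :: "real^('t::{finite,linorder})"
    and \<mu> :: "real^('t::{finite,linorder})^('m \<times> bool)"
  assumes "power_network src tgt \<beta> H c"
    and "cost_functions C"
    and "0 \<le> b"
    and "efficient_market_equilibrium H c b C V U \<Lambda>"
    and "lagrange_multipliers H c b V U \<Lambda> \<gamma> \<mu> \<nu>l \<nu>u"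
  shows "(\<forall>R :: ('n, 'm \<times> bool, 't) rights.
            valid_rights R \<and> simultaneously_feasible H c b R \<longrightarrow>
            transmission_rent \<Lambda> \<mu> R + storage_rent \<Lambda> \<nu>u R \<le> merchandising_surplus \<Lambda> V) \<and>
         (\<exists>R :: ('n, 'm \<times> bool, 't) rights.
            valid_rights R \<and> simultaneously_feasible H c b R \<and>
            transmission_rent \<Lambda> \<mu> R + storage_rent \<Lambda> \<nu>u R = merchandising_surplus \<Lambda> V)"
proof -
  have dispatch: "feasible_dispatch H c b V U"
    using assms(4) by (simp add: efficient_market_equilibrium_def market_equilibrium_def)
  have "transmission_rent \<Lambda> \<mu> R + storage_rent \<Lambda> \<nu>u R \<le> merchandising_surplus \<Lambda> V"
    if "simultaneously_feasible H c b R" for R :: "('n, 'm \<times> bool, 't) rights"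
    unfolding merchandising_surplus_eq_capacity_rent[OF dispatch assms(5)]
    by (rule rent_le_capacity_rent[OF assms(5) that])
  with ex_rights_with_rent_eq_surplus[OF dispatch] show ?thesis by blast
qed

end
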